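(* Let $\delta>0$, $\epsilon>0$, and let $M,N\ge1$ with $M\asymp N$ (i.e. $C_1N\le M\le C_2N$ for fixed $C_1,C_2>0$). Then for $q\in\mathbf{N}$ with $q\le N^{2-\delta}$ and every $k\mid q$, \[ \sum_{\substack{1\le r\le q\\ (r,q)=k}}\Big(\sum_{m\equiv r\ (\mathrm{mod}\ q)}\tau_{M,N}(m)-\frac{MN}{q^2}\sum_{d\mid k}\sum_{c\mid \frac{q}{d}}dc\,\mu\Big(\frac{q}{dc}\Big)\Big)^2\ll\frac{N^{\max(7/2,\,4-\delta)+\epsilon}}{q}, \] uniformly in $q$ and $k$, the implied constant depending on $\delta,\epsilon,C_1,C_2$.
   Context: $\tau_{M,N}(m)=\#\{(a,b)\in\mathbf{N}^2: a\le M,\ b\le N,\ ab=m\}$; $m$ ranges over positive integers; $\mu$ is the Möbius function. *)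

theory Defs
  imports
    "HOL-Analysis.Analysis"
    "HOL-Number_Theory.Number_Theory"
    "HOL-Computational_Algebra.Squarefree"
begin

definition moebius_mu :: "nat \<Rightarrow> int" where
  "moebius_mu n = (if squarefree n then (- 1) ^ card (prime_factors n) else 0)"

definition restricted_divisor_count :: "real \<Rightarrow> real \<Rightarrow> nat \<Rightarrow> nat" where
  "restricted_divisor_count M N m =
     card {(a :: nat, b :: nat). 0 < a \<and> 0 < b \<and> real a \<le> M \<and> real b \<le> N \<and> a * b = m}"

text \<open>The infinite sum below has only finitely many nonzero terms, since
  \<^term>\<open>restricted_divisor_count M N m\<close> vanishes for \<open>m > M * N\<close>.\<close>

definition divisor_progression_sum :: "real \<Rightarrow> real \<Rightarrow> nat \<Rightarrow> nat \<Rightarrow> real" where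
  "divisor_progression_sum M N q r =
     (\<Sum>\<^sub>\<infinity>m\<in>{m. 0 < m \<and> [m = r] (mod q)}. real (restricted_divisor_count M N m))"

definition divisor_progression_main :: "real \<Rightarrow> real \<Rightarrow> nat \<Rightarrow> nat \<Rightarrow> real" where
  "divisor_progression_main M N q k =
     M * N / (real q)\<^sup>2 *
       (\<Sum>d\<in>{d. d dvd k}. \<Sum>c\<in>{c. c dvd q div d}.
          real d * real c * of_int (moebius_mu (q div (d * c))))"

end

theory Submission
  imports Defs
begin

text \<open>
  The main term \<open>W(r)\<close> is \<open>M N / q\<^sup>2\<close> times the number of solutions of \<open>x y \<equiv> r\<close> modulo \<open>q\<close>, so
  its Fourier transform on the residues modulo \<open>q\<close> is \<open>M N gcd(h, q) / q\<close>. By Parseval, the sum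
  over \<^emph>\<open>all\<close> residues \<open>r\<close> equals
  \<open>1/q \<Sum>\<^sub>h |\<Sum>\<^sub>a \<Sum>\<^sub>b e(a b h / q) - M N gcd(h, q) / q|\<^sup>2\<close>. The \<open>a\<close> with \<open>q | a h\<close> reproduce the
  main term up to \<open>O(M + N)\<close>; for the others the sum over \<open>b\<close> is at most \<open>min(N, q / |u|)\<close>, where
  \<open>u \<equiv> a h\<close> is the residue of least absolute value. After a dyadic decomposition in \<open>|u|\<close> one
  counts triples \<open>(h, a, a')\<close> with \<open>a h \<equiv> u\<close>, \<open>a' h \<equiv> u'\<close> and \<open>0 < |u|, |u'| \<le> U\<close>. They satisfy
  \<open>a' u \<equiv> a u'\<close>, so given \<open>(a, u')\<close> the product \<open>a' u\<close> lies in a fixed residue class, the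
  divisor bound controls the pairs \<open>(a', u)\<close>, and then \<open>h\<close> has at most \<open>gcd(a, q)\<close> values. This
  yields \<open>O(N\<^bsup>2+\<epsilon>\<^esup>)\<close>, which is at most \<open>N\<^bsup>4-\<delta>+\<epsilon>\<^esup> / q\<close> for \<open>q \<le> N\<^bsup>2-\<delta>\<^esup>\<close>.
\<close>

section \<open>Moebius function and divisor bound\<close>

lemma squarefree_prime_mult_iff:
  fixes p d :: nat
  assumes "prime p" "\<not> p dvd d"
  shows "squarefree (p * d) \<longleftrightarrow> squarefree d"
proof -
  have "coprime p d"
    using assms by (simp add: prime_imp_coprime)
  moreover have "squarefree p"
    using assms(1) by (simp add: squarefree_prime)
  ultimately show ?thesis
    by (metis squarefree_mult_coprime squarefree_multD(2))
qed

lemma moebius_mu_prime_mult: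
  assumes "prime p" "\<not> p dvd d" "d > 0"
  shows "moebius_mu (p * d) = - moebius_mu d"
proof -
  have "prime_factors (p * d) = insert p (prime_factors d)"
    using assms by (simp add: prime_factors_product prime_prime_factors)
  moreover have "p \<notin> prime_factors d"
    using assms by auto
  ultimately show ?thesis
    using squarefree_prime_mult_iff[OF assms(1,2)]
    by (simp add: moebius_mu_def)
qed

text \<open>Fix a prime p dividing n. Only squarefree divisors contribute, and they split into the
  set \<open>D\<close> of those prime to p and its image under multiplication by p;
  \<open>moebius_mu\<close> changes sign between the two, so they cancel.\<close>

lemma sum_moebius_mu_divisors:
  assumes "n > 0"
  shows "(\<Sum>d\<in>{d. d dvd n}. moebius_mu d) = (if n = 1 then 1 else 0)"
proof (cases "n = 1")
  case True
  then show ?thesis by (simp add: moebius_mu_def)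
next
  case False
  then obtain p where p: "prime p" "p dvd n"
    using prime_factor_nat by blast
  define D where "D = {d. d dvd n \<and> squarefree d \<and> \<not> p dvd d}"
  have fin: "finite D" "finite {d. d dvd n}"
    using assms by (auto simp: D_def)
  have D_pos: "d > 0" if "d \<in> D" for d
    using that assms by (auto simp: D_def intro!: Nat.gr0I)
  have img: "{d. d dvd n \<and> squarefree d} = D \<union> (*) p ` D"
  proof (intro equalityI subsetI)
    fix d assume d: "d \<in> {d. d dvd n \<and> squarefree d}"
    show "d \<in> D \<union> (*) p ` D"
    proof (cases "p dvd d")
      case True
      then obtain e where e: "d = p * e" by auto
      have "\<not> p dvd e"
      proof
        assume "p dvd e"
        then have "p\<^sup>2 dvd d" by (auto simp: e power2_eq_square)
        with d p show False by (auto simp: squarefree_def)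
      qed
      then have "e \<in> D"
        using d squarefree_prime_mult_iff[OF p(1), of e]
        by (auto simp: D_def e dest: dvd_mult_right)
      then show ?thesis by (auto simp: e)
    qed (use d in \<open>auto simp: D_def\<close>)
  next
    fix d assume "d \<in> D \<union> (*) p ` D"
    moreover have "p * e dvd n" if "e \<in> D" for e
      using that p by (intro divides_mult) (auto simp: D_def prime_imp_coprime)
    ultimately show "d \<in> {d. d dvd n \<and> squarefree d}"
      using squarefree_prime_mult_iff[OF p(1)] by (auto simp: D_def)
  qed
  have "(\<Sum>d\<in>{d. d dvd n}. moebius_mu d) = (\<Sum>d\<in>{d. d dvd n \<and> squarefree d}. moebius_mu d)"
    using fin by (intro sum.mono_neutral_right) (auto simp: moebius_mu_def)
  also have "\<dots> = (\<Sum>d\<in>D. moebius_mu d) + (\<Sum>d\<in>(*) p ` D. moebius_mu d)"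
    unfolding img using fin by (intro sum.union_disjoint) (auto simp: D_def)
  also have "(\<Sum>d\<in>(*) p ` D. moebius_mu d) = (\<Sum>d\<in>D. moebius_mu (p * d))"
    using p by (subst sum.reindex) (auto simp: inj_on_def)
  also have "\<dots> = (\<Sum>d\<in>D. - moebius_mu d)"
    using p D_pos by (intro sum.cong) (auto simp: D_def moebius_mu_prime_mult)
  finally show ?thesis
    using False by (simp add: sum_negf)
qed

text \<open>Writing e = c * f and summing over f first leaves the Moebius sum over the divisors of n
  div c, which vanishes unless c = n. The identity evaluates the Fourier transform of the main term
  as a gcd.\<close>

lemma sum_divisors_moebius_convolution:
  fixes n :: nat
  assumes "n > 0"
  shows "(\<Sum>e\<in>{e. e dvd n}. \<Sum>c\<in>{c. c dvd e}. real c * of_int (moebius_mu (e div c))) = real n"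
proof -
  have fin: "finite {d. d dvd m}" if "m dvd n" for m
    using that assms by (auto intro: finite_divisors_nat dvd_pos_nat)
  have "(\<Sum>e\<in>{e. e dvd n}. \<Sum>c\<in>{c. c dvd e}. real c * of_int (moebius_mu (e div c))) =
        (\<Sum>(e, c)\<in>(SIGMA e:{e. e dvd n}. {c. c dvd e}). real c * of_int (moebius_mu (e div c)))"
    using fin by (subst sum.Sigma) auto
  also have "\<dots> = (\<Sum>(c, f)\<in>(SIGMA c:{c. c dvd n}. {f. f dvd n div c}). real c * of_int (moebius_mu f))"
  proof (intro sum.reindex_bij_witness[of _ "\<lambda>(c, f). (c * f, c)" "\<lambda>(e, c). (c, e div c)"], goal_cases)
    case (1 a)
    then show ?case using assms by (auto elim!: dvdE)
  next
    case (2 a)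
    then show ?case using assms by (auto intro: dvd_trans div_dvd_div[THEN iffD2])
  next
    case (3 b)
    then show ?case using assms by (auto elim!: dvdE)
  next
    case (4 b)
    then show ?case using assms
      by (auto simp: dvd_div_iff_mult mult.commute intro!: Nat.gr0I)
  qed auto
  also have "\<dots> = (\<Sum>c\<in>{c. c dvd n}. \<Sum>f\<in>{f. f dvd n div c}. real c * of_int (moebius_mu f))"
    using fin by (subst sum.Sigma) (auto simp: div_dvd_iff_mult)
  also have "\<dots> = (\<Sum>c\<in>{c. c dvd n}. real c * of_int (\<Sum>f\<in>{f. f dvd n div c}. moebius_mu f))"
    by (simp add: sum_distrib_left)
  also have "\<dots> = (\<Sum>c\<in>{c. c dvd n}. if c = n then real n else 0)"
  proof (intro sum.cong refl)
    fix c assume "c \<in> {c. c dvd n}"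
    then have c: "c dvd n" "n div c > 0"
      using assms by (auto elim!: dvdE)
    then have "n div c = 1 \<longleftrightarrow> c = n"
      using assms by (auto elim!: dvdE)
    then show "real c * of_int (\<Sum>f\<in>{f. f dvd n div c}. moebius_mu f) = (if c = n then real n else 0)"
      using c by (simp only: sum_moebius_mu_divisors) auto
  qed
  also have "\<dots> = real n"
    using fin[of n] by simp
  finally show ?thesis .
qed

section \<open>The divisor bound with exponent \<eta>\<close>

abbreviation divisor_count :: "nat \<Rightarrow> nat" where
  "divisor_count n \<equiv> card {d. d dvd n}"

lemma divisor_count_prime_power_mult_le:
  fixes p m :: nat
  assumes "prime p" "m > 0"
  shows "divisor_count (p ^ a * m) \<le> (a + 1) * divisor_count m"
proof -
  have "{d. d dvd p ^ a * m} \<subseteq> (\<lambda>(i, d). p ^ i * d) ` ({..a} \<times> {d. d dvd m})"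
  proof
    fix d assume "d \<in> {d. d dvd p ^ a * m}"
    then obtain b c where "d = b * c" "b dvd p ^ a" "c dvd m"
      using division_decomp by blast
    moreover from this obtain i where "i \<le> a" "b = p ^ i"
      using divides_primepow_nat[OF assms(1)] by blast
    ultimately show "d \<in> (\<lambda>(i, d). p ^ i * d) ` ({..a} \<times> {d. d dvd m})"
      by force
  qed
  then have "divisor_count (p ^ a * m) \<le> card ({..a} \<times> {d. d dvd m})"
    using assms by (intro surj_card_le) auto
  then show ?thesis by (simp add: card_cartesian_product)
qed

text \<open>The quotient of \<open>divisor_count n\<close> by n^\<eta> is a product over prime
  powers p^a of factors (a + 1) / p^(a \<eta>). A factor is at most 1 for p >= \<open>P\<close> and
  at most \<open>K\<close> for p < \<open>P\<close>; fewer than \<open>P\<close> + 1 primes are of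
  the second kind, so K^P serves as the constant.\<close>

lemma divisor_count_bound:
  fixes \<eta> :: real
  assumes "\<eta> > 0"
  obtains C where "C \<ge> 1" "\<And>n. n > 0 \<Longrightarrow> real (divisor_count n) \<le> C * real n powr \<eta>"
proof -
  \<comment> \<open>Beyond this threshold p^\<eta> >= 2, hence p^(a \<eta>) >= 2^a >= a + 1.\<close>
  define P where "P = nat \<lceil>2 powr (1 / \<eta>)\<rceil>"
  \<comment> \<open>Chosen so that a + 1 <= K * (1 + a \<eta> ln 2), whose second factor is at most
    2^(a \<eta>) by the inequality 1 + x <= exp x.\<close>
  define K where "K = 1 + 1 / (\<eta> * ln 2)"
  have K: "K \<ge> 1" using assms by (simp add: K_def)
  have large: "real (a + 1) \<le> (real p ^ a) powr \<eta>" if "p \<ge> P" "p > 0" for p a :: nat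
  proof -
    have "2 powr (1 / \<eta>) \<le> real p"
      using that(1) unfolding P_def by linarith
    then have "(2 powr (1 / \<eta>)) powr \<eta> \<le> real p powr \<eta>"
      using assms by (intro powr_mono2) auto
    then have "2 \<le> real p powr \<eta>"
      using assms by (simp add: powr_powr)
    then have "2 ^ a \<le> (real p powr \<eta>) ^ a"
      by (intro power_mono) auto
    also have "\<dots> = (real p ^ a) powr \<eta>"
      using that(2) by (simp add: powr_powr mult.commute flip: powr_realpow)
    finally have "2 ^ a \<le> (real p ^ a) powr \<eta>" .
    moreover have "real (a + 1) \<le> 2 ^ a"
      using less_exp[of a] by (metis Suc_eq_plus1 Suc_leI of_nat_le_iff of_nat_numeral of_nat_power)
    ultimately show ?thesis by linarith
  qed
  have small: "real (a + 1) \<le> K * (real p ^ a) powr \<eta>" if "p \<ge> 2" for p a :: nat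
  proof -
    have "1 + real a * (\<eta> * ln 2) \<le> exp (real a * (\<eta> * ln 2))"
      by (rule exp_ge_add_one_self)
    also have "\<dots> = (2 ^ a) powr \<eta>"
      by (simp add: powr_def ln_realpow mult_ac)
    also have "\<dots> \<le> (real p ^ a) powr \<eta>"
      using assms that by (intro powr_mono2 power_mono) auto
    finally have "K * (1 + real a * (\<eta> * ln 2)) \<le> K * (real p ^ a) powr \<eta>"
      using K by (intro mult_left_mono) auto
    moreover have "real (a + 1) \<le> K * (1 + real a * (\<eta> * ln 2))"
      using assms by (simp add: K_def field_simps)
    ultimately show ?thesis by linarith
  qed
  \<comment> \<open>Induction removes the full power of one prime at a time; the exponent of
    \<open>K\<close> grows by one exactly when that prime is below \<open>P\<close>.\<close>
  have bound: "real (divisor_count n) \<le> K ^ card {p \<in> prime_factors n. p < P} * real n powr \<eta>"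
    if "n > 0" for n
    using that
  proof (induction n rule: less_induct)
    case (less n)
    show ?case
    proof (cases "n = 1")
      case True
      then show ?thesis by simp
    next
      case False
      then obtain p where p: "prime p" "p dvd n"
        using prime_factor_nat by blast
      define a where "a = multiplicity p n"
      obtain m where m: "n = p ^ a * m" "\<not> p dvd m"
        using multiplicity_decompose'[of n p] less.prems p(1)
        unfolding a_def by (metis not_prime_unit not_gr_zero)
      have "a > 0"
        using p less.prems by (simp add: a_def prime_multiplicity_gt_zero_iff)
      have "p \<ge> 2" using p by (simp add: prime_ge_2_nat)
      have "m > 0" using m less.prems by (auto intro: Nat.gr0I)
      have "1 < p ^ a" using \<open>a > 0\<close> \<open>p \<ge> 2\<close> by (intro one_less_power) auto
      then have "m < n" using m(1) \<open>m > 0\<close> by simp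
      have pf: "prime_factors n = insert p (prime_factors m)"
        using m p \<open>m > 0\<close> \<open>a > 0\<close> \<open>p \<ge> 2\<close>
        by (simp add: prime_factors_product prime_factors_power prime_prime_factors)
      have pnot: "p \<notin> prime_factors m" using m by auto
      let ?c = "\<lambda>n. card {p \<in> prime_factors n. p < P}"
      have "real (a + 1) * K ^ ?c m \<le> K ^ ?c n * (real p ^ a) powr \<eta>"
      proof (cases "p < P")
        case True
        then have "{p \<in> prime_factors n. p < P} = insert p {p \<in> prime_factors m. p < P}"
          by (auto simp: pf)
        then have "?c n = Suc (?c m)"
          using pnot by simp
        then have eq: "K ^ ?c n * (real p ^ a) powr \<eta> = (K * (real p ^ a) powr \<eta>) * K ^ ?c m"
          by simp
        show ?thesis
          unfolding eq using K by (intro mult_right_mono small \<open>p \<ge> 2\<close>) auto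
      next
        case False
        then have "{p \<in> prime_factors n. p < P} = {p \<in> prime_factors m. p < P}"
          by (auto simp: pf)
        then show ?thesis
          using large[of p a] False \<open>p \<ge> 2\<close> K
          by (simp add: mult.commute mult_right_mono)
      qed
      note step = this
      have "real (divisor_count n) \<le> real ((a + 1) * divisor_count m)"
        unfolding m(1) using divisor_count_prime_power_mult_le[OF p(1) \<open>m > 0\<close>] of_nat_le_iff by blast
      also have "\<dots> = real (a + 1) * real (divisor_count m)"
        by (rule of_nat_mult)
      also have "\<dots> \<le> real (a + 1) * (K ^ ?c m * real m powr \<eta>)"
        using less.IH[OF \<open>m < n\<close> \<open>m > 0\<close>] by (intro mult_left_mono) auto
      also have "\<dots> = (real (a + 1) * K ^ ?c m) * real m powr \<eta>"
        by simp
      also have "\<dots> \<le> (K ^ ?c n * (real p ^ a) powr \<eta>) * real m powr \<eta>"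
        by (intro mult_right_mono step) auto
      also have "\<dots> = K ^ ?c n * real n powr \<eta>"
        by (simp add: m(1) powr_mult)
      finally show ?thesis .
    qed
  qed
  show ?thesis
  proof (rule that[of "K ^ P"])
    show "K ^ P \<ge> 1" using K by (rule one_le_power)
    fix n :: nat assume "n > 0"
    have "card {p \<in> prime_factors n. p < P} \<le> card {..<P}"
      by (intro card_mono) auto
    then have "K ^ card {p \<in> prime_factors n. p < P} \<le> K ^ P"
      using K by (intro power_increasing) auto
    then have "K ^ card {p \<in> prime_factors n. p < P} * real n powr \<eta> \<le> K ^ P * real n powr \<eta>"
      by (intro mult_right_mono) auto
    then show "real (divisor_count n) \<le> K ^ P * real n powr \<eta>"
      using bound[OF \<open>n > 0\<close>] by linarith
  qed
qed

section \<open>Additive characters\<close>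

text \<open>The usual e(x / q). The argument is an integer so that differences of residues and
  representatives of least absolute value can be inserted directly.\<close>

definition additive_char :: "nat \<Rightarrow> int \<Rightarrow> complex" where
  "additive_char q x = cis (2 * pi * real_of_int x / real q)"

lemma norm_additive_char [simp]: "norm (additive_char q x) = 1"
  by (simp add: additive_char_def)

lemma additive_char_add: "additive_char q (x + y) = additive_char q x * additive_char q y"
  by (simp add: additive_char_def cis_mult ring_distribs add_divide_distrib)

lemma cnj_additive_char: "cnj (additive_char q x) = additive_char q (- x)"
  by (simp add: additive_char_def cis_cnj)

lemma additive_char_mult_of_nat: "additive_char q (x * int n) = additive_char q x ^ n"
proof -
  have "2 * pi * real_of_int (x * int n) / real q = real n * (2 * pi * real_of_int x / real q)"
    by simp
  then show ?thesis by (simp only: additive_char_def Complex.DeMoivre)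
qed

lemma additive_char_eq_1_iff:
  assumes "q > 0"
  shows "additive_char q x = 1 \<longleftrightarrow> int q dvd x"
proof
  assume "int q dvd x"
  then obtain k where "x = int q * k" by auto
  then have "2 * pi * real_of_int x / real q = 2 * pi * of_int k"
    using assms by simp
  then show "additive_char q x = 1"
    by (simp only: additive_char_def cis_multiple_2pi Ints_of_int)
next
  assume "additive_char q x = 1"
  then have "cos (2 * pi * real_of_int x / real q) = 1"
    by (simp add: additive_char_def complex_eq_iff)
  then obtain n :: int where "2 * pi * real_of_int x / real q = of_int n * 2 * pi"
    by (auto simp: cos_one_2pi_int)
  then have "real_of_int x = real_of_int (n * int q)"
    using assms by (simp add: field_simps)
  then have "x = n * int q"
    by (simp only: of_int_eq_iff)
  then show "int q dvd x" by simp
qed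

lemma additive_char_cong:
  assumes "[x = y] (mod int q)" "q > 0"
  shows "additive_char q x = additive_char q y"
proof -
  have "additive_char q x = additive_char q (x - y) * additive_char q y"
    by (simp flip: additive_char_add)
  also have "additive_char q (x - y) = 1"
    using assms by (simp add: additive_char_eq_1_iff cong_iff_dvd_diff)
  finally show ?thesis by simp
qed

lemma geometric_sum_from_1:
  fixes z :: "'a :: field"
  assumes "z \<noteq> 1"
  shows "(\<Sum>i\<in>{1..n}. z ^ i) = z * (z ^ n - 1) / (z - 1)"
proof -
  have "(\<Sum>i\<in>{1..n}. z ^ i) = (\<Sum>i<n. z ^ Suc i)"
    by (rule sum.reindex_bij_witness[of _ Suc "\<lambda>i. i - 1"]) auto
  also have "\<dots> = z * (\<Sum>i<n. z ^ i)"
    by (simp add: sum_distrib_left)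
  finally show ?thesis
    using assms by (simp add: geometric_sum)
qed

lemma sum_additive_char:
  assumes "q > 0"
  shows "(\<Sum>r\<in>{1..q}. additive_char q (x * int r)) = (if int q dvd x then of_nat q else 0)"
proof -
  have "additive_char q x ^ q = 1"
    using assms by (simp add: additive_char_eq_1_iff flip: additive_char_mult_of_nat)
  then show ?thesis
    using assms geometric_sum_from_1[of "additive_char q x" q] additive_char_eq_1_iff[OF assms, of x]
    by (cases "int q dvd x") (simp_all add: additive_char_mult_of_nat)
qed

text \<open>Expand the square into a double sum over r and s and sum over h first: orthogonality
  keeps only r congruent to s, and two elements of {1..q} that are congruent modulo q are
  equal.\<close>

lemma parseval_residues:
  fixes f :: "nat \<Rightarrow> complex"
  assumes "q > 0"
  shows "(\<Sum>h\<in>{1..q}. (norm (\<Sum>r\<in>{1..q}. f r * additive_char q (int h * int r)))\<^sup>2) =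
         real q * (\<Sum>r\<in>{1..q}. (norm (f r))\<^sup>2)"
proof -
  let ?e = "additive_char q"
  have "complex_of_real (\<Sum>h\<in>{1..q}. (norm (\<Sum>r\<in>{1..q}. f r * ?e (int h * int r)))\<^sup>2) =
     (\<Sum>h\<in>{1..q}. (\<Sum>r\<in>{1..q}. f r * ?e (int h * int r)) * cnj (\<Sum>r\<in>{1..q}. f r * ?e (int h * int r)))"
    by (simp add: complex_norm_square flip: of_real_power del: cnj_sum)
  also have "\<dots> = (\<Sum>h\<in>{1..q}. \<Sum>r\<in>{1..q}. \<Sum>s\<in>{1..q}. f r * cnj (f s) * ?e ((int r - int s) * int h))"
    by (simp add: sum_product cnj_additive_char mult_ac flip: additive_char_add)
       (simp add: algebra_simps flip: additive_char_add)
  also have "\<dots> = (\<Sum>r\<in>{1..q}. \<Sum>s\<in>{1..q}. \<Sum>h\<in>{1..q}. f r * cnj (f s) * ?e ((int r - int s) * int h))"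
    by (subst sum.swap, rule sum.cong[OF refl], rule sum.swap)
  also have "\<dots> = (\<Sum>r\<in>{1..q}. \<Sum>s\<in>{1..q}. if s = r then f r * cnj (f r) * of_nat q else 0)"
  proof (intro sum.cong refl)
    fix r s assume rs: "r \<in> {1..q}" "s \<in> {1..q}"
    have "int q dvd int r - int s \<longleftrightarrow> s = r"
    proof
      assume "int q dvd int r - int s"
      moreover have "\<bar>int r - int s\<bar> < int q" using rs by auto
      ultimately show "s = r" using zdvd_imp_le[of "int q" "\<bar>int r - int s\<bar>"] by fastforce
    qed auto
    then show "(\<Sum>h\<in>{1..q}. f r * cnj (f s) * ?e ((int r - int s) * int h)) =
                 (if s = r then f r * cnj (f r) * of_nat q else 0)"
      using sum_additive_char[OF assms, of "int r - int s"]
      by (simp flip: sum_distrib_left)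
  qed
  also have "\<dots> = complex_of_real (real q * (\<Sum>r\<in>{1..q}. (norm (f r))\<^sup>2))"
    by (simp add: complex_norm_square sum_distrib_left mult_ac flip: of_real_power)
  finally show ?thesis
    by (simp only: of_real_eq_iff)
qed

section \<open>Bounds for incomplete exponential sums\<close>

lemma sin_ge_half:
  fixes x :: real
  assumes "0 \<le> x" "x \<le> pi / 2"
  shows "x / 2 \<le> sin x"
proof -
  have "(\<Sum>m<3. sin_coeff m * x ^ m) = x"
    by (simp add: sin_coeff_def numeral_3_eq_3)
  then have "\<bar>sin x - x\<bar> \<le> x ^ 3 / 6"
    using Maclaurin_sin_bound[of x 3] assms(1) by (simp add: fact_numeral field_simps)
  \<comment> \<open>This amounts to x^2 <= 3, which holds because pi / 2 < 8 / 5; the cubic Taylor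
    remainder then costs at most half of x.\<close>
  moreover have "x ^ 3 / 6 \<le> x / 2"
  proof -
    have "x \<le> 8 / 5" using assms(2) pi_approx by simp
    then have "x\<^sup>2 \<le> (8 / 5)\<^sup>2" using assms(1) by (intro power_mono)
    then have "x\<^sup>2 \<le> 3" by (simp add: power2_eq_square)
    then have "x * x\<^sup>2 \<le> x * 3" using assms(1) by (intro mult_left_mono)
    then show ?thesis by (simp add: power3_eq_cube power2_eq_square)
  qed
  ultimately show ?thesis by linarith
qed

text \<open>In the closed form of the geometric sum the numerator has norm at most 2, while the
  denominator is 2 |sin (pi u / q)| >= pi |u| / q >= 2 |u| / q. The condition 2 |u| <= q keeps the
  angle within the range of \<open>sin_ge_half\<close>.\<close>

lemma norm_sum_additive_char_le:
  fixes u :: int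
  assumes "q > 0" "u \<noteq> 0" "2 * \<bar>u\<bar> \<le> int q"
  shows "norm (\<Sum>b\<in>{1..n}. additive_char q (u * int b)) \<le> real q / real_of_int \<bar>u\<bar>"
proof -
  let ?z = "additive_char q u"
  let ?x = "pi * real_of_int \<bar>u\<bar> / real q"
  have "\<not> int q dvd u"
    using assms zdvd_imp_le[of "int q" "\<bar>u\<bar>"] by auto
  then have ne: "?z \<noteq> 1" using assms by (simp add: additive_char_eq_1_iff)
  have x: "0 \<le> ?x" "?x \<le> pi / 2"
  proof -
    have "2 * real_of_int \<bar>u\<bar> \<le> real q" using assms(3) by linarith
    then show "?x \<le> pi / 2" using assms(1) by (simp add: field_simps)
  qed auto
  have "norm (?z - 1) = 2 * \<bar>sin (pi * real_of_int u / real q)\<bar>"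
    using dist_exp_i_1[of "2 * pi * real_of_int u / real q"]
    by (simp add: additive_char_def cis_conv_exp)
  also have "\<bar>sin (pi * real_of_int u / real q)\<bar> = \<bar>sin ?x\<bar>"
    by (cases "u \<ge> 0") auto
  also have "2 * \<dots> \<ge> 2 * sin ?x" by simp
  also have "2 * sin ?x \<ge> 2 * (?x / 2)"
    using sin_ge_half[OF x] by (intro mult_left_mono) auto
  finally have "norm (?z - 1) \<ge> ?x" by simp
  moreover have "?x \<ge> 2 * (real_of_int \<bar>u\<bar> / real q)"
    using pi_ge_two assms(1) by (simp add: divide_right_mono mult_right_mono)
  ultimately have lower: "norm (?z - 1) \<ge> 2 * (real_of_int \<bar>u\<bar> / real q)" by linarith
  have pos: "0 < real_of_int \<bar>u\<bar> / real q" using assms by simp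
  have "norm (\<Sum>b\<in>{1..n}. additive_char q (u * int b)) = norm (?z ^ n - 1) / norm (?z - 1)"
    unfolding additive_char_mult_of_nat geometric_sum_from_1[OF ne]
    by (simp add: norm_mult norm_divide)
  also have "norm (?z ^ n - 1) \<le> 2"
    using norm_triangle_ineq4[of "?z ^ n" 1] by (simp add: norm_power)
  then have "norm (?z ^ n - 1) / norm (?z - 1) \<le> 2 / (2 * (real_of_int \<bar>u\<bar> / real q))"
    using lower pos by (intro frac_le) auto
  finally show ?thesis by simp
qed

section \<open>Second moment of additive character sums\<close>

lemma card_multiples_atMost:
  fixes d m :: nat
  assumes "d > 0"
  shows "card {a\<in>{1..m}. d dvd a} = m div d"
proof -
  have "bij_betw ((*) d) {1..m div d} {a\<in>{1..m}. d dvd a}"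
    using assms
    by (intro bij_betwI[of _ _ _ "\<lambda>a. a div d"])
       (auto simp: div_le_mono less_eq_div_iff_mult_less_eq mult.commute div_greater_zero_iff dvd_imp_le
          Suc_le_eq)
  then show ?thesis
    by (simp add: bij_betw_same_card[symmetric])
qed

text \<open>Bound gcd(a, q) by the sum of all common divisors d of a and q; after swapping the sums,
  each d | q contributes d * (m div d) <= m.\<close>

lemma sum_gcd_le:
  fixes q m :: nat
  assumes "q > 0"
  shows "(\<Sum>a\<in>{1..m}. gcd a q) \<le> m * divisor_count q"
proof -
  have fin: "finite {d. d dvd q}" using assms by simp
  have "(\<Sum>a\<in>{1..m}. gcd a q) \<le> (\<Sum>a\<in>{1..m}. \<Sum>d\<in>{d. d dvd q}. if d dvd a then d else 0)"
  proof (rule sum_mono)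
    fix a
    have "gcd a q = (\<Sum>d\<in>{gcd a q}. if d dvd a then d else 0)" by simp
    also have "\<dots> \<le> (\<Sum>d\<in>{d. d dvd q}. if d dvd a then d else 0)"
      using fin by (intro sum_mono2) auto
    finally show "gcd a q \<le> (\<Sum>d\<in>{d. d dvd q}. if d dvd a then d else 0)" .
  qed
  also have "\<dots> = (\<Sum>d\<in>{d. d dvd q}. \<Sum>a\<in>{1..m}. if d dvd a then d else 0)"
    by (rule sum.swap)
  also have "\<dots> = (\<Sum>d\<in>{d. d dvd q}. card {a\<in>{1..m}. d dvd a} * d)"
    by (simp flip: sum.inter_filter)
  also have "\<dots> \<le> (\<Sum>d\<in>{d. d dvd q}. m)"
  proof (rule sum_mono)
    fix d assume "d \<in> {d. d dvd q}"
    then have "d > 0" using assms by (auto intro: Nat.gr0I)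
    then show "card {a\<in>{1..m}. d dvd a} * d \<le> m"
      by (simp only: card_multiples_atMost div_times_less_eq_dividend)
  qed
  finally show ?thesis by (simp add: mult.commute)
qed

text \<open>Any two solutions agree modulo e = q / gcd(a, q), and {1..q} consists of gcd(a, q)
  blocks of e consecutive integers, each holding at most one solution.\<close>

lemma card_linear_cong_le:
  fixes q a :: nat and u :: int
  assumes "q > 0"
  shows "card {h\<in>{1..q}. [int a * int h = u] (mod int q)} \<le> gcd a q"
proof -
  define g e where "g = gcd a q" and "e = q div g"
  have g: "g > 0" "q = g * e" using assms by (auto simp: g_def e_def)
  then have e: "e > 0" using assms by auto
  \<comment> \<open>The index of the block containing h; the shift by one is needed because the
    residues start at 1.\<close>
  have "inj_on (\<lambda>h. (h - 1) div e) {h\<in>{1..q}. [int a * int h = u] (mod int q)}"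
  proof (rule inj_onI, clarsimp)
    fix h h' assume h: "Suc 0 \<le> h" "Suc 0 \<le> h'"
      and cong: "[int a * int h = u] (mod int q)" "[int a * int h' = u] (mod int q)"
      and eq: "(h - Suc 0) div e = (h' - Suc 0) div e"
    have a: "a = g * (a div g)" by (simp add: g_def)
    have "coprime (a div g) e"
      unfolding e_def g_def using assms by (intro div_gcd_coprime) auto
    have "[int a * int h = int a * int h'] (mod int q)"
      using cong_trans[OF cong(1) cong_sym[OF cong(2)]] .
    then have "int q dvd int a * (int h - int h')"
      by (simp add: cong_iff_dvd_diff right_diff_distrib)
    also have "int a * (int h - int h') = int g * (int (a div g) * (int h - int h'))"
      using arg_cong[OF a, of int] by simp
    finally have "int e dvd int (a div g) * (int h - int h')"
      using g by simp
    then have "int e dvd int h - int h'"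
      using \<open>coprime (a div g) e\<close>
      by (subst (asm) coprime_dvd_mult_right_iff) (simp_all add: coprime_commute)
    then have "[h = h'] (mod e)"
      by (simp add: cong_iff_dvd_diff flip: cong_int_iff)
    then have "[h - Suc 0 = h' - Suc 0] (mod e)"
      using h by (intro cong_diff_nat) auto
    then have "h - Suc 0 = h' - Suc 0"
      using eq unfolding cong_def by (metis div_mult_mod_eq)
    then show "h = h'" using h by linarith
  qed
  moreover have "(\<lambda>h. (h - 1) div e) ` {h\<in>{1..q}. [int a * int h = u] (mod int q)} \<subseteq> {..<g}"
    using e g by (auto simp: less_mult_imp_div_less)
  ultimately have "card {h\<in>{1..q}. [int a * int h = u] (mod int q)} \<le> card {..<g}"
    by (intro card_inj_on_le) auto
  then show ?thesis by (simp add: g_def)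
qed

text \<open>After translation by \<open>X\<close> the values lie in [0, 2X], and within one residue
  class the quotient by q determines the value.\<close>

lemma card_symmetric_interval_cong_le:
  fixes q X :: nat and c :: int
  assumes "q > 0"
  shows "card {v. \<bar>v\<bar> \<le> int X \<and> [v = c] (mod int q)} \<le> 2 * X div q + 1"
proof -
  let ?V = "{v. \<bar>v\<bar> \<le> int X \<and> [v = c] (mod int q)}"
  have "inj_on (\<lambda>v. (v + int X) div int q) ?V"
  proof (rule inj_onI, clarsimp)
    fix v w assume *: "[v = c] (mod int q)" "[w = c] (mod int q)"
      "(v + int X) div int q = (w + int X) div int q"
    then have "[v + int X = w + int X] (mod int q)"
      by (metis cong_add_rcancel cong_sym cong_trans)
    then show "v = w"
      using *(3) unfolding cong_def by (metis add_right_cancel div_mult_mod_eq)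
  qed
  moreover have "(\<lambda>v. (v + int X) div int q) ` ?V \<subseteq> {0..int (2 * X div q)}"
  proof (rule image_subsetI)
    fix v assume v: "v \<in> ?V"
    then have "0 \<le> (v + int X) div int q"
      using assms by (auto simp: pos_imp_zdiv_nonneg_iff)
    moreover have "(v + int X) div int q \<le> (2 * int X) div int q"
      using v assms by (intro zdiv_mono1) auto
    ultimately show "(v + int X) div int q \<in> {0..int (2 * X div q)}"
      by (simp add: zdiv_int)
  qed
  ultimately have "card ?V \<le> card {0..int (2 * X div q)}"
    by (intro card_inj_on_le) auto
  then show ?thesis by simp
qed

text \<open>Sort the pairs by the product v = a * u. It has size at most m * U and lies in a fixed
  class, which leaves at most 2 m U / q + 1 values. For v nonzero, a is a divisor of |v| and
  determines u, so \<open>D\<close> bounds the pairs; v = 0 does not arise from nonzero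
  factors.\<close>

lemma card_product_cong_le:
  fixes q m U D :: nat and c :: int
  assumes "q > 0" and D: "\<And>v. 0 < v \<Longrightarrow> v \<le> m * U \<Longrightarrow> divisor_count v \<le> D"
  defines "S \<equiv> {(a, u). a \<in> {1..m} \<and> u \<noteq> 0 \<and> \<bar>u\<bar> \<le> int U \<and> [int a * u = c] (mod int q)}"
  shows "finite S" and "card S \<le> (2 * (m * U) div q + 1) * D"
proof -
  have "S \<subseteq> {1..m} \<times> {- int U..int U}"
    by (auto simp: S_def)
  then show fin: "finite S" by (rule finite_subset) auto
  let ?V = "{v. \<bar>v\<bar> \<le> int (m * U) \<and> [v = c] (mod int q)}"
  define F where "F v = {(a, u). a \<in> {1..m} \<and> u \<noteq> 0 \<and> \<bar>u\<bar> \<le> int U \<and> int a * u = v}" for v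
  have "?V \<subseteq> {- int (m * U)..int (m * U)}" by auto
  then have finV: "finite ?V" by (rule finite_subset) auto
  have finF: "finite (F v)" for v
    by (rule finite_subset[of _ "{1..m} \<times> {- int U..int U}"]) (auto simp: F_def)
  have "S \<subseteq> (\<Union>v\<in>?V. F v)"
  proof (clarsimp simp: S_def F_def)
    fix a :: nat and u :: int assume "a \<le> m" "\<bar>u\<bar> \<le> int U"
    then show "\<bar>int a * u\<bar> \<le> int m * int U"
      unfolding abs_mult by (intro mult_mono) auto
  qed
  then have "card S \<le> card (\<Union>v\<in>?V. F v)"
    using finV finF by (intro card_mono) auto
  also have "\<dots> \<le> (\<Sum>v\<in>?V. card (F v))"
    using finV by (rule card_UN_le)
  also have "\<dots> \<le> (\<Sum>v\<in>?V. D)"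
  proof (rule sum_mono)
    fix v assume v: "v \<in> ?V"
    show "card (F v) \<le> D"
    proof (cases "v = 0")
      case True
      then have "F v = {}" by (auto simp: F_def)
      then show ?thesis by simp
    next
      case False
      have "inj_on fst (F v)" by (auto simp: inj_on_def F_def)
      moreover have "fst ` F v \<subseteq> {d. d dvd nat \<bar>v\<bar>}"
        by (auto simp: F_def abs_mult nat_mult_distrib)
      ultimately have "card (F v) \<le> divisor_count (nat \<bar>v\<bar>)"
        using False by (intro card_inj_on_le finite_divisors_nat) auto
      also have "\<dots> \<le> D" using False v by (intro D) (auto simp: nat_le_iff)
      finally show ?thesis .
    qed
  qed
  also have "\<dots> = card ?V * D" by simp
  also have "\<dots> \<le> (2 * (m * U) div q + 1) * D"
    using card_symmetric_interval_cong_le[OF assms(1), of "m * U" c] by (intro mult_right_mono) auto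
  finally show "card S \<le> (2 * (m * U) div q + 1) * D" .
qed

section \<open>Dyadic decomposition by the size of the residue of a * h\<close>

definition small_residue :: "nat \<Rightarrow> nat \<Rightarrow> nat \<Rightarrow> bool" where
  "small_residue q U t \<longleftrightarrow> (\<exists>u. u \<noteq> 0 \<and> \<bar>u\<bar> \<le> int U \<and> [int t = u] (mod int q))"

text \<open>The left side counts triples (h, a, a'). With representatives u of a * h and u' of a' *
  h, both a' * u and a * u' are congruent to a * a' * h, so for given (a, u') the pair (a', u) is
  controlled by \<open>card_product_cong_le\<close>, and h then solves a linear congruence.\<close>

lemma card_small_residue_triples_le:
  fixes q m U D :: nat
  assumes "q > 0" and D: "\<And>v. 0 < v \<Longrightarrow> v \<le> m * U \<Longrightarrow> divisor_count v \<le> D"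
  shows "(\<Sum>h\<in>{1..q}. (card {a\<in>{1..m}. small_residue q U (a * h)})\<^sup>2)
           \<le> 2 * U * (2 * (m * U) div q + 1) * D * (m * divisor_count q)"
proof -
  let ?X = "\<lambda>h. {a\<in>{1..m}. small_residue q U (a * h)}"
  let ?I = "{- int U..int U} - {0}"
  define S where "S c = {(a, u). a \<in> {1..m} \<and> u \<noteq> 0 \<and> \<bar>u\<bar> \<le> int U \<and> [int a * u = c] (mod int q)}" for c
  define H where "H a u = {h\<in>{1..q}. [int a * int h = u] (mod int q)}" for a :: nat and u
  define B where "B = (2 * (m * U) div q + 1) * D"
  have S: "finite (S c)" "card (S c) \<le> B" for c
    unfolding S_def B_def using card_product_cong_le[OF assms(1) D] by blast+
  have H: "finite (H a u)" "card (H a u) \<le> gcd a q" for a u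
    unfolding H_def using card_linear_cong_le[OF assms(1)] by auto
  \<comment> \<open>The nesting records the order of choice: a, then u', then p = (a', u), then
    h.\<close>
  define Q where "Q = (SIGMA a:{1..m}. SIGMA u':?I. SIGMA p:S (int a * u'). H a (snd p))"
  have finQ: "finite Q"
    unfolding Q_def using S H by (intro finite_SigmaI) auto
  have "(\<Sum>h\<in>{1..q}. (card (?X h))\<^sup>2) = card (SIGMA h:{1..q}. ?X h \<times> ?X h)"
    by (simp add: power2_eq_square card_cartesian_product)
  also have "\<dots> \<le> card Q"
  \<comment> \<open>A triple may admit several pairs (u, u'), so \<open>Q\<close> only covers the
    triples; this suffices for an upper bound.\<close>
  proof (rule surj_card_le[OF finQ])
    show "(SIGMA h:{1..q}. ?X h \<times> ?X h) \<subseteq> (\<lambda>(a, u', p, h). (h, a, fst p)) ` Q"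
    proof clarify
      fix h a a' assume h: "h \<in> {1..q}" and a: "a \<in> {1..m}" "a' \<in> {1..m}"
        and "small_residue q U (a * h)" "small_residue q U (a' * h)"
      then obtain u u' where u: "u \<noteq> 0" "\<bar>u\<bar> \<le> int U" "[int a * int h = u] (mod int q)"
        and u': "u' \<noteq> 0" "\<bar>u'\<bar> \<le> int U" "[int a' * int h = u'] (mod int q)"
        by (auto simp: small_residue_def)
      have "[int a' * u = int a' * (int a * int h)] (mod int q)"
        using u(3) by (intro cong_mult cong_refl) (rule cong_sym)
      also have "int a' * (int a * int h) = int a * (int a' * int h)" by simp
      also have "[int a * (int a' * int h) = int a * u'] (mod int q)"
        using u'(3) by (intro cong_mult cong_refl)
      finally have "(a', u) \<in> S (int a * u')"
        using a u by (auto simp: S_def)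
      then have "(a, u', (a', u), h) \<in> Q"
        using h a u u' by (auto simp: Q_def H_def)
      then show "(h, a, a') \<in> (\<lambda>(a, u', p, h). (h, a, fst p)) ` Q"
        by (force simp: image_iff)
    qed
  qed
  also have "\<dots> = (\<Sum>a\<in>{1..m}. \<Sum>u'\<in>?I. \<Sum>p\<in>S (int a * u'). card (H a (snd p)))"
    unfolding Q_def using S H by (subst card_SigmaI, force, force)+ simp
  also have "\<dots> \<le> (\<Sum>a\<in>{1..m}. \<Sum>u'\<in>?I. \<Sum>p\<in>S (int a * u'). gcd a q)"
    using H by (intro sum_mono) auto
  also have "\<dots> \<le> (\<Sum>a\<in>{1..m}. \<Sum>u'\<in>?I. B * gcd a q)"
    using S by (intro sum_mono) (auto intro!: mult_right_mono)
  also have "\<dots> = 2 * U * B * (\<Sum>a\<in>{1..m}. gcd a q)"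
  proof -
    have "card ?I = 2 * U" by (subst card_Diff_singleton) auto
    then show ?thesis by (simp only: sum_constant sum_distrib_left mult_ac of_nat_id)
  qed
  also have "\<dots> \<le> 2 * U * B * (m * divisor_count q)"
    using sum_gcd_le[OF assms(1)] by (intro mult_left_mono) auto
  finally show ?thesis by (simp only: B_def mult_ac)
qed

text \<open>Replaces min(n, q / |u|) by a sum of indicators of dyadic conditions, so that summation
  over a turns it into a combination of counts. A single index j already dominates the norm; the
  other terms are nonnegative.\<close>

lemma norm_sum_additive_char_le_dyadic:
  fixes q t n J :: nat
  assumes "q > 0" "\<not> q dvd t" "n < 2 ^ Suc J"
  shows "norm (\<Sum>b\<in>{1..n}. additive_char q (int t * int b))
           \<le> (\<Sum>j\<le>J. if small_residue q (q div 2 ^ j) t then 2 ^ Suc j else 0)"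
proof -
  \<comment> \<open>The representative of least absolute value.\<close>
  obtain u :: int where u: "[int t = u] (mod int q)" "2 * \<bar>u\<bar> \<le> int q"
  proof (cases "2 * (t mod q) \<le> q")
    case True
    then show ?thesis
      by (intro that[of "int (t mod q)"]) (auto simp: cong_def zmod_int[symmetric])
  next
    case False
    moreover have "2 * \<bar>int s - int q\<bar> \<le> int q" if "\<not> 2 * s \<le> q" "s < q" for s
    proof -
      have "\<bar>int s - int q\<bar> = int q - int s" using that(2) by simp
      moreover have "int q < 2 * int s" using that(1) by simp
      ultimately show ?thesis by simp
    qed
    ultimately have "2 * \<bar>int (t mod q) - int q\<bar> \<le> int q"
      using assms(1) by (meson mod_less_divisor)
    then show ?thesis
      by (intro that[of "int (t mod q) - int q"]) (auto simp: cong_def zmod_int)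
  qed
  have "u \<noteq> 0"
    using u(1) assms(2) by (auto simp: cong_0_iff)
  define A where "A = {j. j \<le> J \<and> 2 ^ j * \<bar>u\<bar> \<le> int q}"
  have A: "finite A" "0 \<in> A" using u(2) by (auto simp: A_def)
  \<comment> \<open>The largest admissible index: for i = J the trivial bound n < 2^(J + 1) applies,
    and for i < J maximality gives q / |u| < 2^(i + 1).\<close>
  define i where "i = Max A"
  have "i \<in> A" unfolding i_def using A by (intro Max_in) auto
  then have i: "i \<le> J" "2 ^ i * \<bar>u\<bar> \<le> int q" by (auto simp: A_def)
  have "\<bar>u\<bar> \<le> int q div 2 ^ i"
    using zdiv_mono1[OF i(2), of "2 ^ i"] by simp
  then have small: "small_residue q (q div 2 ^ i) t"
    using u(1) \<open>u \<noteq> 0\<close> by (auto simp: small_residue_def zdiv_int)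
  let ?s = "\<Sum>b\<in>{1..n}. additive_char q (int t * int b)"
  have eq: "?s = (\<Sum>b\<in>{1..n}. additive_char q (u * int b))"
    using u(1) assms(1) by (intro sum.cong additive_char_cong cong_mult cong_refl) auto
  have "norm ?s \<le> 2 ^ Suc i"
  proof (cases "i = J")
    case True
    have "norm ?s \<le> (\<Sum>b\<in>{1..n}. 1)"
      by (rule sum_norm_le) simp
    also have "\<dots> \<le> 2 ^ Suc i"
      using assms(3) True of_nat_less_iff[of n "2 ^ Suc J", where 'a = real] by simp
    finally show ?thesis .
  next
    case False
    then have "Suc i \<notin> A" using Max_ge[OF A(1), of "Suc i"] by (auto simp: i_def)
    then have "int q < 2 ^ Suc i * \<bar>u\<bar>"
      using False i(1) by (auto simp: A_def)
    then have "real_of_int (int q) < real_of_int (2 ^ Suc i * \<bar>u\<bar>)"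
      by (simp only: of_int_less_iff)
    then have "real q / real_of_int \<bar>u\<bar> \<le> 2 ^ Suc i"
      using \<open>u \<noteq> 0\<close> by (simp add: field_simps)
    then show ?thesis
      unfolding eq using norm_sum_additive_char_le[OF assms(1) \<open>u \<noteq> 0\<close> u(2), of n] by linarith
  qed
  also have "\<dots> = (\<Sum>j\<in>{i}. if small_residue q (q div 2 ^ j) t then 2 ^ Suc j else 0)"
    using small by simp
  also have "\<dots> \<le> (\<Sum>j\<le>J. if small_residue q (q div 2 ^ j) t then 2 ^ Suc j else 0)"
    using i(1) by (intro sum_mono2) auto
  finally show ?thesis .
qed

text \<open>Each dyadic range contributes at most \<open>T\<close> to the second moment, uniformly
  in j. Cauchy-Schwarz over the J + 1 ranges and the summation over j cost one factor J + 1
  each.\<close>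

lemma second_moment_additive_char_sums_le:
  fixes q m n J D :: nat
  assumes "q > 0" and J: "2 ^ J \<le> n" "n < 2 ^ Suc J"
    and D: "\<And>v. 0 < v \<Longrightarrow> v \<le> m * q \<Longrightarrow> divisor_count v \<le> D"
  shows "(\<Sum>h\<in>{1..q}. (\<Sum>a\<in>{a\<in>{1..m}. \<not> q dvd a * h}.
             norm (\<Sum>b\<in>{1..n}. additive_char q (int (a * h) * int b)))\<^sup>2)
           \<le> 8 * (real J + 1)\<^sup>2 * real q * real D * real (divisor_count q) * real m * (2 * real m + real n)"
proof -
  define X where "X j h = card {a\<in>{1..m}. small_residue q (q div 2 ^ j) (a * h)}" for j h
  define T where "T = 2 * real q * real D * real (divisor_count q) * real m * (2 * real m + real n)"
  let ?S = "\<lambda>h. \<Sum>a\<in>{a\<in>{1..m}. \<not> q dvd a * h}.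
             norm (\<Sum>b\<in>{1..n}. additive_char q (int (a * h) * int b))"
  have S: "?S h \<le> (\<Sum>j\<le>J. 2 ^ Suc j * real (X j h))" for h
  proof -
    have "?S h \<le> (\<Sum>a\<in>{a\<in>{1..m}. \<not> q dvd a * h}.
                    \<Sum>j\<le>J. if small_residue q (q div 2 ^ j) (a * h) then 2 ^ Suc j else 0)"
      using assms(1) J by (intro sum_mono norm_sum_additive_char_le_dyadic) auto
    also have "\<dots> \<le> (\<Sum>a\<in>{1..m}. \<Sum>j\<le>J. if small_residue q (q div 2 ^ j) (a * h) then 2 ^ Suc j else 0)"
      by (intro sum_mono2 sum_nonneg) auto
    also have "\<dots> = (\<Sum>j\<le>J. \<Sum>a\<in>{1..m}. if small_residue q (q div 2 ^ j) (a * h) then 2 ^ Suc j else 0)"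
      by (rule sum.swap)
    also have "\<dots> = (\<Sum>j\<le>J. 2 ^ Suc j * real (X j h))"
      by (simp add: X_def mult_ac flip: sum.inter_filter)
    finally show ?thesis .
  qed
  \<comment> \<open>With U = q div 2^j, one factor 2^j is absorbed by 2^j U <= q; the other turns 2
    m U / q + 1 into at most 2 m + 2^j <= 2 m + n, which is where 2^J <= n enters.\<close>
  have moment: "4 ^ j * (\<Sum>h\<in>{1..q}. (real (X j h))\<^sup>2) \<le> T" if "j \<le> J" for j
  proof -
    have four: "(4::real) ^ j = 2 ^ j * 2 ^ j"
      by (simp flip: power_mult_distrib)
    define U where "U = q div 2 ^ j"
    have "U \<le> q" by (simp add: U_def)
    have "real U \<le> real q / 2 ^ j"
      unfolding U_def using of_nat_div_le_of_nat[of q "2 ^ j"] by simp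
    then have U: "2 ^ j * real U \<le> real q" by (simp add: field_simps)
    have "2 ^ j * real (2 * (m * U) div q) \<le> 2 ^ j * (real (2 * (m * U)) / real q)"
      by (intro mult_left_mono of_nat_div_le_of_nat) auto
    also have "\<dots> = 2 * real m * (2 ^ j * real U / real q)" by simp
    also have "\<dots> \<le> 2 * real m * 1"
      using U assms(1) by (intro mult_left_mono) auto
    finally have 1: "2 ^ j * real (2 * (m * U) div q) \<le> 2 * real m" by simp
    have "(2::nat) ^ j \<le> n" using J(1) that by (meson le_trans one_le_numeral power_increasing)
    then have 2: "2 ^ j \<le> real n" using of_nat_le_iff[of "2 ^ j" n, where 'a = real] by simp
    have "(\<Sum>h\<in>{1..q}. (X j h)\<^sup>2) \<le> 2 * U * (2 * (m * U) div q + 1) * D * (m * divisor_count q)"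
      unfolding X_def U_def[symmetric]
    proof (rule card_small_residue_triples_le[OF assms(1)])
      fix v assume "0 < v" "v \<le> m * U"
      then show "divisor_count v \<le> D"
        using \<open>U \<le> q\<close> by (intro D) (auto intro: order.trans mult_left_mono)
    qed
    then have "real (\<Sum>h\<in>{1..q}. (X j h)\<^sup>2) \<le> real (2 * U * (2 * (m * U) div q + 1) * D * (m * divisor_count q))"
      by (simp only: of_nat_le_iff)
    then have "4 ^ j * (\<Sum>h\<in>{1..q}. (real (X j h))\<^sup>2) \<le>
               4 ^ j * real (2 * U * (2 * (m * U) div q + 1) * D * (m * divisor_count q))"
      by (simp del: of_nat_mult)
    also have "4 ^ j * real (2 * U * (2 * (m * U) div q + 1) * D * (m * divisor_count q)) =
        2 * (2 ^ j * real U) * (2 ^ j * real (2 * (m * U) div q) + 2 ^ j) * (real D * real (divisor_count q) * real m)"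
      unfolding four by (simp add: algebra_simps)
    also have "\<dots> \<le> 2 * real q * (2 * real m + real n) * (real D * real (divisor_count q) * real m)"
      by (rule mult_right_mono[OF mult_mono[OF mult_left_mono[OF U] add_mono[OF 1 2]]]) auto
    finally show ?thesis by (simp only: T_def mult_ac)
  qed
  have "(\<Sum>h\<in>{1..q}. (?S h)\<^sup>2) \<le> (\<Sum>h\<in>{1..q}. (\<Sum>j\<le>J. 2 ^ Suc j * real (X j h))\<^sup>2)"
    by (intro sum_mono power_mono S sum_nonneg) auto
  also have "\<dots> \<le> (\<Sum>h\<in>{1..q}. (\<Sum>j\<le>J. (2 ^ Suc j * real (X j h))\<^sup>2) * real (card {..J}))"
    by (intro sum_mono sum_squared_le_sum_of_squares)
  also have "\<dots> = 4 * (real J + 1) * (\<Sum>h\<in>{1..q}. \<Sum>j\<le>J. 4 ^ j * (real (X j h))\<^sup>2)"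
  proof -
    have "(2 ^ Suc j * x)\<^sup>2 * (real J + 1) = 4 * (real J + 1) * (4 ^ j * x\<^sup>2)" for j and x :: real
    proof -
      have "(4::real) ^ j = 2 ^ j * 2 ^ j" by (simp flip: power_mult_distrib)
      then show ?thesis by (simp add: power2_eq_square algebra_simps)
    qed
    moreover have "real (card {..J}) = real J + 1" by simp
    ultimately show ?thesis by (simp only: sum_distrib_left sum_distrib_right)
  qed
  also have "(\<Sum>h\<in>{1..q}. \<Sum>j\<le>J. 4 ^ j * (real (X j h))\<^sup>2) = (\<Sum>j\<le>J. 4 ^ j * (\<Sum>h\<in>{1..q}. (real (X j h))\<^sup>2))"
    by (subst sum.swap) (simp add: sum_distrib_left)
  also have "4 * (real J + 1) * \<dots> \<le> 4 * (real J + 1) * (\<Sum>j\<le>J. T)"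
    by (intro mult_left_mono sum_mono moment) auto
  also have "\<dots> = 4 * (real J + 1)\<^sup>2 * T"
    by (simp add: power2_eq_square mult_ac)
  finally show ?thesis by (simp add: T_def mult_ac)
qed

section \<open>Variance over residue classes\<close>

lemma restricted_divisor_count_eq:
  "restricted_divisor_count M N k =
     card {p\<in>{1..nat \<lfloor>M\<rfloor>} \<times> {1..nat \<lfloor>N\<rfloor>}. fst p * snd p = k}"
proof -
  have iff: "0 < a \<and> real a \<le> x \<longleftrightarrow> a \<in> {1..nat \<lfloor>x\<rfloor>}" for a :: nat and x
    by (auto simp: le_nat_floor) linarith
  have "{(a :: nat, b :: nat). 0 < a \<and> 0 < b \<and> real a \<le> M \<and> real b \<le> N \<and> a * b = k} =
        {p\<in>{1..nat \<lfloor>M\<rfloor>} \<times> {1..nat \<lfloor>N\<rfloor>}. fst p * snd p = k}"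
    using iff[of _ M] iff[of _ N] unfolding set_eq_iff mem_Collect_eq mem_Times_iff by fastforce
  then show ?thesis by (simp add: restricted_divisor_count_def)
qed

lemma divisor_progression_sum_eq:
  "divisor_progression_sum M N q r =
     (\<Sum>a\<in>{1..nat \<lfloor>M\<rfloor>}. \<Sum>b\<in>{1..nat \<lfloor>N\<rfloor>}. if [a * b = r] (mod q) then 1 else 0)"
proof -
  let ?P = "{1..nat \<lfloor>M\<rfloor>} \<times> {1..nat \<lfloor>N\<rfloor>}"
  let ?K = "{k\<in>(\<lambda>p. fst p * snd p) ` ?P. [k = r] (mod q)}"
  have "divisor_progression_sum M N q r = (\<Sum>\<^sub>\<infinity>k\<in>?K. real (restricted_divisor_count M N k))"
    unfolding divisor_progression_sum_def
  \<comment> \<open>The count vanishes outside the products a * b of the box \<open>?P\<close>, so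
    the infinite sum reduces to a finite index set.\<close>
  proof (rule infsum_cong_neutral)
    fix k assume "k \<in> {k. 0 < k \<and> [k = r] (mod q)} - ?K"
    then have "{p\<in>?P. fst p * snd p = k} = {}" by force
    then show "real (restricted_divisor_count M N k) = 0"
      by (simp add: restricted_divisor_count_eq)
  qed auto
  also have "\<dots> = (\<Sum>k\<in>?K. real (restricted_divisor_count M N k))"
    by (rule infsum_finite) auto
  also have "\<dots> = (\<Sum>k\<in>?K. \<Sum>p\<in>?P. if fst p * snd p = k then 1 else 0)"
    by (simp add: restricted_divisor_count_eq flip: sum.inter_filter)
  also have "\<dots> = (\<Sum>p\<in>?P. \<Sum>k\<in>?K. if fst p * snd p = k then 1 else 0)"
    by (rule sum.swap)
  also have "\<dots> = (\<Sum>p\<in>?P. if [fst p * snd p = r] (mod q) then 1 else 0)"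
    by (intro sum.cong refl) (auto simp: sum.delta')
  also have "\<dots> = (\<Sum>a\<in>{1..nat \<lfloor>M\<rfloor>}. \<Sum>b\<in>{1..nat \<lfloor>N\<rfloor>}. if [a * b = r] (mod q) then 1 else 0)"
    by (simp add: sum.cartesian_product case_prod_unfold)
  finally show ?thesis .
qed

section \<open>Fourier transforms of the progression sum and of the main term\<close>

lemma sum_cong_additive_char:
  fixes q h x :: nat
  assumes "q > 0"
  shows "(\<Sum>r\<in>{1..q}. if [x = r] (mod q) then additive_char q (int h * int r) else 0) =
           additive_char q (int h * int x)"
proof -
  \<comment> \<open>The representative of x in {1..q}: the zero class is represented by q instead of
    0.\<close>
  define s where "s = (if q dvd x then q else x mod q)"
  have s: "s \<in> {1..q}" "[x = s] (mod q)"
    using assms by (auto simp: s_def cong_def Suc_le_eq mod_greater_zero_iff_not_dvd less_imp_le)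
  have "[x = r] (mod q) \<longleftrightarrow> r = s" if "r \<in> {1..q}" for r
  proof
    assume "[x = r] (mod q)"
    then have "[int r = int s] (mod int q)"
      using s(2) by (metis cong_int_iff cong_sym cong_trans)
    then have "int q dvd int r - int s" by (simp add: cong_iff_dvd_diff)
    moreover have "\<bar>int r - int s\<bar> < int q" using s that by auto
    ultimately show "r = s"
      using zdvd_imp_le[of "int q" "\<bar>int r - int s\<bar>"] by fastforce
  qed (use s in auto)
  then have "(\<Sum>r\<in>{1..q}. if [x = r] (mod q) then additive_char q (int h * int r) else 0) =
             (\<Sum>r\<in>{1..q}. if r = s then additive_char q (int h * int s) else 0)"
    by (intro sum.cong) auto
  also have "\<dots> = additive_char q (int h * int s)"
    using s(1) by simp
  also have "\<dots> = additive_char q (int h * int x)"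
    using s(2) assms by (intro additive_char_cong cong_mult cong_refl) (auto simp: cong_int_iff cong_sym)
  finally show ?thesis .
qed

lemma fourier_divisor_progression_sum:
  fixes q h :: nat
  assumes "q > 0"
  shows "(\<Sum>r\<in>{1..q}. complex_of_real (divisor_progression_sum M N q r) * additive_char q (int h * int r)) =
           (\<Sum>a\<in>{1..nat \<lfloor>M\<rfloor>}. \<Sum>b\<in>{1..nat \<lfloor>N\<rfloor>}. additive_char q (int (a * h) * int b))"
proof -
  let ?A = "{1..nat \<lfloor>M\<rfloor>}" and ?B = "{1..nat \<lfloor>N\<rfloor>}"
  have "(\<Sum>r\<in>{1..q}. complex_of_real (divisor_progression_sum M N q r) * additive_char q (int h * int r)) =
        (\<Sum>r\<in>{1..q}. \<Sum>a\<in>?A. \<Sum>b\<in>?B. if [a * b = r] (mod q) then additive_char q (int h * int r) else 0)"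
    by (auto simp: divisor_progression_sum_eq sum_distrib_right intro!: sum.cong)
  also have "\<dots> = (\<Sum>a\<in>?A. \<Sum>r\<in>{1..q}. \<Sum>b\<in>?B. if [a * b = r] (mod q) then additive_char q (int h * int r) else 0)"
    by (rule sum.swap)
  also have "\<dots> = (\<Sum>a\<in>?A. \<Sum>b\<in>?B. \<Sum>r\<in>{1..q}. if [a * b = r] (mod q) then additive_char q (int h * int r) else 0)"
    by (intro sum.cong refl sum.swap)
  also have "\<dots> = (\<Sum>a\<in>?A. \<Sum>b\<in>?B. additive_char q (int (a * h) * int b))"
    unfolding sum_cong_additive_char[OF assms] by (simp add: mult_ac)
  finally show ?thesis .
qed

lemma additive_char_cancel:
  assumes "d > 0"
  shows "additive_char (d * e) (int d * x) = additive_char e x"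
proof -
  have "2 * pi * real_of_int (int d * x) / real (d * e) = 2 * pi * real_of_int x / real e"
    using assms by simp
  then show ?thesis by (simp only: additive_char_def)
qed

text \<open>Substituting r = d * s turns this into a complete character sum modulo q div d.\<close>

lemma sum_multiples_additive_char:
  fixes q d h :: nat
  assumes "q > 0" "d dvd q"
  shows "(\<Sum>r\<in>{1..q}. if d dvd r then additive_char q (int h * int r) else 0) =
           (if q div d dvd h then of_nat (q div d) else 0)"
proof -
  define e where "e = q div d"
  have q: "q = d * e" "d > 0" "e > 0" using assms by (auto simp: e_def elim!: dvdE)
  have "(\<Sum>r\<in>{1..q}. if d dvd r then additive_char q (int h * int r) else 0) =
        (\<Sum>r\<in>{r\<in>{1..q}. d dvd r}. additive_char q (int h * int r))"
    by (simp flip: sum.inter_filter)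
  also have "\<dots> = (\<Sum>s\<in>{1..e}. additive_char q (int h * int (d * s)))"
    using q by (intro sum.reindex_bij_witness[of _ "\<lambda>s. d * s" "\<lambda>r. r div d"])
      (auto simp: Suc_le_eq div_greater_zero_iff dvd_imp_le)
  also have "\<dots> = (\<Sum>s\<in>{1..e}. additive_char e (int h * int s))"
  proof (intro sum.cong refl)
    fix s
    have "int h * int (d * s) = int d * (int h * int s)" by simp
    then show "additive_char q (int h * int (d * s)) = additive_char e (int h * int s)"
      unfolding q(1) by (simp only: additive_char_cancel[OF q(2)])
  qed
  also have "\<dots> = (if e dvd h then of_nat e else 0)"
    using sum_additive_char[OF q(3), of "int h"] by simp
  finally show ?thesis by (simp add: e_def)
qed

text \<open>The main term is a combination of the indicators of d | r over d | q. The transform of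
  such an indicator is q / d when q div d divides h and 0 otherwise, which cancels the weight d;
  with e = q div d there remains the sum of \<open>G e\<close> over e | gcd(h, q).\<close>

lemma fourier_divisor_progression_main:
  fixes q h :: nat
  assumes "q > 0"
  shows "(\<Sum>r\<in>{1..q}. complex_of_real (divisor_progression_main M N q (gcd r q)) * additive_char q (int h * int r)) =
           complex_of_real (M * N * real (gcd h q) / real q)"
proof -
  \<comment> \<open>For positive x this is Euler's totient, written as the convolution of the
    identity with the Moebius function.\<close>
  define G where "G x = (\<Sum>c\<in>{c. c dvd x}. real c * of_int (moebius_mu (x div c)))" for x
  define K where "K = M * N / (real q)\<^sup>2"
  have fin: "finite {d. d dvd q}" using assms by simp
  have main: "divisor_progression_main M N q (gcd r q) =
      (\<Sum>d\<in>{d. d dvd q}. if d dvd r then K * (real d * G (q div d)) else 0)" for r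
  proof -
    have "divisor_progression_main M N q (gcd r q) = K * (\<Sum>d\<in>{d\<in>{d. d dvd q}. d dvd r}. real d * G (q div d))"
      unfolding divisor_progression_main_def K_def G_def
      by (simp add: sum_distrib_left mult_ac div_mult2_eq conj_commute)
    then show ?thesis
      using fin by (simp add: sum_distrib_left flip: sum.inter_filter)
  qed
  have "(\<Sum>r\<in>{1..q}. complex_of_real (divisor_progression_main M N q (gcd r q)) * additive_char q (int h * int r)) =
        (\<Sum>r\<in>{1..q}. \<Sum>d\<in>{d. d dvd q}. of_real (K * (real d * G (q div d))) *
            (if d dvd r then additive_char q (int h * int r) else 0))"
    unfolding main of_real_sum sum_distrib_right by (intro sum.cong refl) auto
  also have "\<dots> = (\<Sum>d\<in>{d. d dvd q}. of_real (K * (real d * G (q div d))) *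
            (\<Sum>r\<in>{1..q}. if d dvd r then additive_char q (int h * int r) else 0))"
    by (subst sum.swap) (simp add: sum_distrib_left)
  also have "\<dots> = (\<Sum>d\<in>{d. d dvd q}. of_real (K * real q * (if q div d dvd h then G (q div d) else 0)))"
  proof (intro sum.cong refl)
    fix d assume "d \<in> {d. d dvd q}"
    then have d: "d dvd q" by simp
    define e where "e = q div d"
    have "real q = real d * real e" using d by (simp add: e_def flip: of_nat_mult)
    then show "of_real (K * (real d * G (q div d))) *
            (\<Sum>r\<in>{1..q}. if d dvd r then additive_char q (int h * int r) else 0) =
         complex_of_real (K * real q * (if q div d dvd h then G (q div d) else 0))"
      unfolding sum_multiples_additive_char[OF assms d] e_def[symmetric] by simp
  qed
  also have "\<dots> = of_real (K * real q * (\<Sum>d\<in>{d. d dvd q}. if q div d dvd h then G (q div d) else 0))"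
    by (simp add: sum_distrib_left)
  also have "(\<Sum>d\<in>{d. d dvd q}. if q div d dvd h then G (q div d) else 0) =
             (\<Sum>e\<in>{e. e dvd q}. if e dvd h then G e else 0)"
    using assms by (intro sum.reindex_bij_witness[of _ "\<lambda>e. q div e" "\<lambda>e. q div e"])
      (auto elim!: dvdE)
  also have "\<dots> = (\<Sum>e\<in>{e. e dvd gcd h q}. G e)"
    using fin by (simp add: conj_commute flip: sum.inter_filter)
  also have "\<dots> = real (gcd h q)"
    unfolding G_def using assms by (intro sum_divisors_moebius_convolution) auto
  finally show ?thesis
    using assms by (simp add: K_def power2_eq_square)
qed

text \<open>Compares the exact contribution of the multiples of e with the transform M N / e of the
  main term. With x = M / e, split x N - x' y' = x (N - y') + y' (x - x'); both differences lie in
  [0, 1], while x <= M and y' <= N.\<close>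

lemma floor_div_mult_floor_bound:
  fixes M N :: real and e :: nat
  assumes "M \<ge> 0" "N \<ge> 0" "e > 0"
  shows "\<bar>real (nat \<lfloor>M\<rfloor> div e) * real (nat \<lfloor>N\<rfloor>) - M * N / real e\<bar> \<le> M + N"
proof -
  define x x' y' where "x = M / real e" and "x' = real (nat \<lfloor>M\<rfloor> div e)" and "y' = real (nat \<lfloor>N\<rfloor>)"
  have y: "0 \<le> y'" "y' \<le> N" "N \<le> y' + 1"
    using assms(2) unfolding y'_def by linarith+
  have "x' \<le> real (nat \<lfloor>M\<rfloor>) / real e"
    unfolding x'_def by (rule of_nat_div_le_of_nat)
  also have "\<dots> \<le> x"
    unfolding x_def using assms by (intro divide_right_mono) auto
  finally have "x' \<le> x" .
  \<comment> \<open>A strict inequality between integers leaves room for adding 1 on the left, so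
    the two successive roundings together still lose at most 1 in x.\<close>
  have "nat \<lfloor>M\<rfloor> < e * (nat \<lfloor>M\<rfloor> div e + 1)"
    using assms(3) by (metis Suc_eq_plus1 dividend_less_times_div mult_Suc_right add.commute)
  then have "real (nat \<lfloor>M\<rfloor> + 1) \<le> real (e * (nat \<lfloor>M\<rfloor> div e + 1))"
    by (intro of_nat_mono) simp
  moreover have "M \<le> real (nat \<lfloor>M\<rfloor> + 1)" using assms(1) by linarith
  ultimately have "M \<le> real e * (x' + 1)" by (simp add: x'_def algebra_simps)
  then have "x \<le> x' + 1" using assms(3) by (simp add: x_def field_simps)
  have "x \<le> M"
  proof -
    have "M * 1 \<le> M * real e" using assms by (intro mult_left_mono) auto
    then show ?thesis using assms(3) by (simp add: x_def divide_le_eq)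
  qed
  have "0 \<le> x" using assms by (simp add: x_def)
  have "x * N - x' * y' = x * (N - y') + y' * (x - x')" by (simp add: algebra_simps)
  moreover have "x * (N - y') \<le> M * 1" "y' * (x - x') \<le> N * 1"
    using y \<open>x \<le> M\<close> \<open>0 \<le> x\<close> \<open>x \<le> x' + 1\<close> \<open>x' \<le> x\<close> assms by (intro mult_mono; simp)+
  moreover have "0 \<le> x * (N - y')" "0 \<le> y' * (x - x')"
    using y \<open>0 \<le> x\<close> \<open>x' \<le> x\<close> by auto
  ultimately have "\<bar>x' * y' - x * N\<bar> \<le> M + N" by linarith
  then show ?thesis by (simp add: x_def x'_def y'_def)
qed

text \<open>By Parseval, q times the variance is the second moment over h of the transform of the
  error. For each h the a with q | a * h cancel the main term up to M + N, and the remaining a are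
  bounded by \<open>S h\<close>, whose second moment is known.\<close>

lemma divisor_progression_variance_le:
  fixes M N :: real and q J D :: nat
  assumes MN: "M \<ge> 0" "N \<ge> 0" and "q > 0"
    and J: "2 ^ J \<le> nat \<lfloor>N\<rfloor>" "nat \<lfloor>N\<rfloor> < 2 ^ Suc J"
    and D: "\<And>v. 0 < v \<Longrightarrow> v \<le> nat \<lfloor>M\<rfloor> * q \<Longrightarrow> divisor_count v \<le> D"
  shows "(\<Sum>r\<in>{1..q}. (divisor_progression_sum M N q r - divisor_progression_main M N q (gcd r q))\<^sup>2)
           \<le> 2 * (M + N)\<^sup>2 + 16 * (real J + 1)\<^sup>2 * real D * real (divisor_count q) * M * (2 * M + N)"
proof -
  define m n where "m = nat \<lfloor>M\<rfloor>" and "n = nat \<lfloor>N\<rfloor>"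
  have mn: "real m \<le> M" "real n \<le> N" using MN by (auto simp: m_def n_def)
  define f where "f r = divisor_progression_sum M N q r - divisor_progression_main M N q (gcd r q)" for r
  define S where "S h = (\<Sum>a\<in>{a\<in>{1..m}. \<not> q dvd a * h}.
             norm (\<Sum>b\<in>{1..n}. additive_char q (int (a * h) * int b)))" for h
  have hat: "norm (\<Sum>r\<in>{1..q}. complex_of_real (f r) * additive_char q (int h * int r)) \<le> (M + N) + S h"
    if "h \<in> {1..q}" for h
  proof -
    define e where "e = q div gcd h q"
    have e: "e > 0" "q = e * gcd h q" using \<open>q > 0\<close> by (auto simp: e_def div_greater_zero_iff)
    let ?s = "\<lambda>a. \<Sum>b\<in>{1..n}. additive_char q (int (a * h) * int b)"
    \<comment> \<open>Hence the a with trivial inner sum are the multiples of e = q div gcd(h, q),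
      and there are exactly m div e of them.\<close>
    have dvd_iff: "q dvd a * h \<longleftrightarrow> e dvd a" for a
    proof -
      have "coprime e (h div gcd h q)"
        unfolding e_def using \<open>q > 0\<close> by (metis coprime_commute div_gcd_coprime not_gr_zero)
      have "q dvd a * h \<longleftrightarrow> e * gcd h q dvd (a * (h div gcd h q)) * gcd h q"
      proof -
        have "a * h = a * (h div gcd h q) * gcd h q" by simp
        then show ?thesis unfolding e(2)[symmetric] by (simp only:)
      qed
      also have "\<dots> \<longleftrightarrow> e dvd a * (h div gcd h q)"
        using \<open>q > 0\<close> by simp
      also have "\<dots> \<longleftrightarrow> e dvd a"
        using \<open>coprime e (h div gcd h q)\<close> by (rule coprime_dvd_mult_left_iff)
      finally show ?thesis .
    qed
    have "(\<Sum>a\<in>{a\<in>{1..m}. q dvd a * h}. ?s a) = (\<Sum>a\<in>{a\<in>{1..m}. q dvd a * h}. of_nat n)"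
    proof (intro sum.cong refl)
      fix a assume "a \<in> {a\<in>{1..m}. q dvd a * h}"
      then have "additive_char q (int (a * h)) = 1"
        using \<open>q > 0\<close> by (simp only: additive_char_eq_1_iff of_nat_dvd_iff) simp
      then show "?s a = of_nat n"
        by (simp only: additive_char_mult_of_nat) simp
    qed
    also have "\<dots> = complex_of_real (real (m div e) * real n)"
      using card_multiples_atMost[OF e(1), of m] by (simp add: dvd_iff)
    finally have zero: "(\<Sum>a\<in>{a\<in>{1..m}. q dvd a * h}. ?s a) = complex_of_real (real (m div e) * real n)" .
    have "(\<Sum>a\<in>{1..m}. ?s a) = (\<Sum>a\<in>{a\<in>{1..m}. q dvd a * h}. ?s a) + (\<Sum>a\<in>{a\<in>{1..m}. \<not> q dvd a * h}. ?s a)"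
      by (subst sum.union_disjoint[symmetric]) (auto intro!: sum.cong)
    moreover have "real (gcd h q) / real q = 1 / real e"
      using e \<open>q > 0\<close> arg_cong[OF e(2), of real] by (simp add: field_simps)
    then have "M * N * real (gcd h q) / real q = M * N / real e"
      by (metis mult.right_neutral times_divide_eq_right)
    moreover have "(\<Sum>r\<in>{1..q}. complex_of_real (f r) * additive_char q (int h * int r)) =
        (\<Sum>a\<in>{1..m}. ?s a) - complex_of_real (M * N * real (gcd h q) / real q)"
      unfolding fourier_divisor_progression_main[OF \<open>q > 0\<close>, symmetric]
        m_def n_def fourier_divisor_progression_sum[OF \<open>q > 0\<close>, symmetric]
      by (simp add: f_def left_diff_distrib sum_subtractf)
    ultimately have "(\<Sum>r\<in>{1..q}. complex_of_real (f r) * additive_char q (int h * int r)) =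
        complex_of_real (real (m div e) * real n - M * N / real e) + (\<Sum>a\<in>{a\<in>{1..m}. \<not> q dvd a * h}. ?s a)"
      by (simp only: zero of_real_diff) simp
    also have "norm \<dots> \<le> \<bar>real (m div e) * real n - M * N / real e\<bar> + S h"
      unfolding S_def
      by (intro order.trans[OF norm_triangle_ineq] add_mono norm_sum) (simp only: norm_of_real order.refl)
    also have "\<dots> \<le> (M + N) + S h"
      unfolding m_def n_def using floor_div_mult_floor_bound[OF MN e(1)] by (rule add_right_mono)
    finally show ?thesis .
  qed
  have "real q * (\<Sum>r\<in>{1..q}. (f r)\<^sup>2) =
      (\<Sum>h\<in>{1..q}. (norm (\<Sum>r\<in>{1..q}. complex_of_real (f r) * additive_char q (int h * int r)))\<^sup>2)"
    using parseval_residues[OF \<open>q > 0\<close>, of "\<lambda>r. complex_of_real (f r)"] by simp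
  also have "\<dots> \<le> (\<Sum>h\<in>{1..q}. 2 * (M + N)\<^sup>2 + 2 * (S h)\<^sup>2)"
  proof (rule sum_mono)
    fix h assume "h \<in> {1..q}"
    then have "(norm (\<Sum>r\<in>{1..q}. complex_of_real (f r) * additive_char q (int h * int r)))\<^sup>2 \<le> ((M + N) + S h)\<^sup>2"
      by (intro power_mono hat) auto
    also have "\<dots> \<le> 2 * (M + N)\<^sup>2 + 2 * (S h)\<^sup>2"
      using sum_squares_bound[of "M + N" "S h"] by (simp add: power2_sum)
    finally show "(norm (\<Sum>r\<in>{1..q}. complex_of_real (f r) * additive_char q (int h * int r)))\<^sup>2 \<le>
        2 * (M + N)\<^sup>2 + 2 * (S h)\<^sup>2" .
  qed
  also have "\<dots> = real q * (2 * (M + N)\<^sup>2) + 2 * (\<Sum>h\<in>{1..q}. (S h)\<^sup>2)"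
    by (simp add: sum.distrib sum_distrib_left)
  also have "(\<Sum>h\<in>{1..q}. (S h)\<^sup>2) \<le>
      8 * (real J + 1)\<^sup>2 * real q * real D * real (divisor_count q) * real m * (2 * real m + real n)"
    unfolding S_def using J D
    by (intro second_moment_additive_char_sums_le \<open>q > 0\<close>) (auto simp: m_def n_def)
  also have "\<dots> \<le> 8 * (real J + 1)\<^sup>2 * real q * real D * real (divisor_count q) * M * (2 * M + N)"
    using mn MN by (intro mult_mono mult_nonneg_nonneg add_mono) auto
  finally have "real q * (\<Sum>r\<in>{1..q}. (f r)\<^sup>2) \<le> real q *
      (2 * (M + N)\<^sup>2 + 16 * (real J + 1)\<^sup>2 * real D * real (divisor_count q) * M * (2 * M + N))"
    by (simp add: algebra_simps)
  then show ?thesis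
    unfolding f_def using \<open>q > 0\<close> by simp
qed

section \<open>Choice of parameters and the final estimate\<close>

theorem theorem1p8:
  fixes \<delta> \<epsilon> C1 C2 :: real
  assumes "\<delta> > 0" and "\<epsilon> > 0" and "C1 > 0" and "C2 > 0"
  shows "\<exists>K :: real. \<forall>(M :: real) (N :: real) (q :: nat) (k :: nat).
           M \<ge> 1 \<longrightarrow> N \<ge> 1 \<longrightarrow> C1 * N \<le> M \<longrightarrow> M \<le> C2 * N \<longrightarrow>
           q \<ge> 1 \<longrightarrow> real q \<le> N powr (2 - \<delta>) \<longrightarrow> k dvd q \<longrightarrow>
           (\<Sum>r\<in>{r. 1 \<le> r \<and> r \<le> q \<and> gcd r q = k}.
              (divisor_progression_sum M N q r - divisor_progression_main M N q k)\<^sup>2)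
             \<le> K * N powr (max (7 / 2) (4 - \<delta>) + \<epsilon>) / real q"
proof -
  \<comment> \<open>The power of N^\<eta> that accumulates is 7: two from the square of J + 1, three
    from \<open>D\<close> and two from \<open>divisor_count q\<close>.\<close>
  define \<eta> where "\<eta> = \<epsilon> / 7"
  have "\<eta> > 0" using assms by (simp add: \<eta>_def)
  obtain C where C: "C \<ge> 1" "\<And>n. n > 0 \<Longrightarrow> real (divisor_count n) \<le> C * real n powr \<eta>"
    using divisor_count_bound[OF \<open>\<eta> > 0\<close>] by blast
  define K where "K = 2 * (C2 + 1)\<^sup>2 + 16 * C\<^sup>2 * (C * C2 powr \<eta> + 1) * C * C2 * (2 * C2 + 1)"
  show ?thesis
  proof (intro exI[of _ K] allI impI)
    fix M N :: real and q k :: nat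
    assume M: "1 \<le> M" "C1 * N \<le> M" "M \<le> C2 * N" and N: "1 \<le> N"
      and q: "1 \<le> q" "real q \<le> N powr (2 - \<delta>)" and k: "k dvd q"
    have "N powr (2 - \<delta>) \<le> N powr 2" using N assms(1) by (intro powr_mono) auto
    with q have qN: "real q \<le> N powr 2" by simp
    define n where "n = nat \<lfloor>N\<rfloor>"
    have n: "n \<ge> 1" "real n \<le> N" using N by (auto simp: n_def le_nat_floor)
    obtain J where J: "2 ^ J \<le> n" "n < 2 ^ Suc J"
      using ex_power_ivl1[of 2 n] n(1) by auto
    \<comment> \<open>The numbers v to be factored are at most M q <= C2 N^3, since q <=
      N^2.\<close>
    define D where "D = nat \<lfloor>C * (C2 * N powr 3) powr \<eta>\<rfloor>"
    have D: "divisor_count v \<le> D" if v: "0 < v" "v \<le> nat \<lfloor>M\<rfloor> * q" for v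
    proof -
      have "real v \<le> real (nat \<lfloor>M\<rfloor> * q)" using v(2) by (simp only: of_nat_le_iff)
      also have "\<dots> = real (nat \<lfloor>M\<rfloor>) * real q" by simp
      also have "\<dots> \<le> (C2 * N) * N powr 2"
      proof (rule mult_mono)
        show "real (nat \<lfloor>M\<rfloor>) \<le> C2 * N" using M by linarith
      qed (use qN N assms in auto)
      also have "\<dots> = C2 * N powr 3"
        using N by (simp add: powr_numeral power2_eq_square power3_eq_cube)
      finally have "real v powr \<eta> \<le> (C2 * N powr 3) powr \<eta>"
        using \<open>\<eta> > 0\<close> by (intro powr_mono2) auto
      then have "C * real v powr \<eta> \<le> C * (C2 * N powr 3) powr \<eta>"
        using C(1) by (intro mult_left_mono) auto
      then show ?thesis
        unfolding D_def using C(2)[OF v(1)] by (intro le_nat_floor) linarith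
    qed
    have D_le: "real D \<le> (C * C2 powr \<eta> + 1) * N powr (3 * \<eta>)"
    proof -
      have "real D \<le> C * (C2 * N powr 3) powr \<eta>"
        unfolding D_def using C(1) by (intro of_nat_floor) auto
      also have "\<dots> = C * C2 powr \<eta> * N powr (3 * \<eta>)"
        using assms N by (simp add: powr_mult powr_powr del: powr_numeral)
      also have "\<dots> \<le> (C * C2 powr \<eta> + 1) * N powr (3 * \<eta>)"
        by (intro mult_right_mono) auto
      finally show ?thesis .
    qed
    have q_le: "real (divisor_count q) \<le> C * N powr (2 * \<eta>)"
    proof -
      have "real q powr \<eta> \<le> (N powr 2) powr \<eta>"
        using qN \<open>\<eta> > 0\<close> by (intro powr_mono2) auto
      then have "real q powr \<eta> \<le> N powr (2 * \<eta>)" by (simp only: powr_powr)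
      then have "C * real q powr \<eta> \<le> C * N powr (2 * \<eta>)"
        using C(1) by (intro mult_left_mono) auto
      then show ?thesis using C(2)[of q] q(1) by linarith
    qed
    have J_le: "real J + 1 \<le> C * N powr \<eta>"
    proof -
      \<comment> \<open>The divisor bound at \<open>2 ^ J\<close> doubles as a bound for the number of dyadic ranges.\<close>
      have "{d. d dvd (2::nat) ^ J} = (\<lambda>i. 2 ^ i) ` {..J}"
        by (auto simp: divides_primepow_nat le_imp_power_dvd)
      then have "divisor_count (2 ^ J) = J + 1"
        by (simp add: card_image inj_on_def)
      then have "real J + 1 \<le> C * real (2 ^ J) powr \<eta>"
        using C(2)[of "2 ^ J"] by simp
      also have "\<dots> \<le> C * N powr \<eta>"
      proof -
        have "real (2 ^ J) \<le> real n" using J(1) by (simp only: of_nat_le_iff)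
        then have "real (2 ^ J) \<le> N" using n(2) by linarith
        then show ?thesis using C(1) \<open>\<eta> > 0\<close> by (intro mult_left_mono powr_mono2) auto
      qed
      finally show ?thesis .
    qed
    let ?f = "\<lambda>r. (divisor_progression_sum M N q r - divisor_progression_main M N q (gcd r q))\<^sup>2"
    have "(\<Sum>r\<in>{r. 1 \<le> r \<and> r \<le> q \<and> gcd r q = k}.
              (divisor_progression_sum M N q r - divisor_progression_main M N q k)\<^sup>2) =
          (\<Sum>r\<in>{r. 1 \<le> r \<and> r \<le> q \<and> gcd r q = k}. ?f r)"
      by (intro sum.cong) auto
    \<comment> \<open>With k rewritten as gcd(r, q), the terms make sense for every r; being
      squares, they may be added for all residues, which makes Parseval applicable.\<close>
    also have "\<dots> \<le> (\<Sum>r\<in>{1..q}. ?f r)"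
      by (intro sum_mono2) auto
    also have "\<dots> \<le> 2 * (M + N)\<^sup>2 + 16 * (real J + 1)\<^sup>2 * real D * real (divisor_count q) * M * (2 * M + N)"
      using M N q J D by (intro divisor_progression_variance_le) (auto simp: n_def)
    also have "\<dots> \<le> 2 * (C2 * N + N)\<^sup>2 + 16 * (C * N powr \<eta>)\<^sup>2 * ((C * C2 powr \<eta> + 1) * N powr (3 * \<eta>)) *
        (C * N powr (2 * \<eta>)) * (C2 * N) * (2 * (C2 * N) + N)"
      using M N J_le D_le q_le C(1) assms
      by (intro add_mono mult_mono power_mono mult_nonneg_nonneg) auto
    also have "\<dots> = 2 * (C2 + 1)\<^sup>2 * N powr 2 + 16 * C\<^sup>2 * (C * C2 powr \<eta> + 1) * C * C2 * (2 * C2 + 1) *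
        ((N powr \<eta>)\<^sup>2 * N powr (3 * \<eta>) * N powr (2 * \<eta>) * N powr 2)"
      using N by (simp add: powr_numeral power2_eq_square algebra_simps)
    also have "(N powr \<eta>)\<^sup>2 * N powr (3 * \<eta>) * N powr (2 * \<eta>) * N powr 2 = N powr (2 + \<epsilon>)"
      by (simp add: \<eta>_def power2_eq_square add.commute flip: powr_add)
    also have "2 * (C2 + 1)\<^sup>2 * N powr 2 \<le> 2 * (C2 + 1)\<^sup>2 * N powr (2 + \<epsilon>)"
      using N assms by (intro mult_left_mono powr_mono) auto
    finally have bound: "(\<Sum>r\<in>{r. 1 \<le> r \<and> r \<le> q \<and> gcd r q = k}.
              (divisor_progression_sum M N q r - divisor_progression_main M N q k)\<^sup>2) \<le> K * N powr (2 + \<epsilon>)"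
      by (simp add: K_def algebra_simps)
    \<comment> \<open>The bound K N^(2 + \<epsilon>) is traded for one with denominator q by means
      of q <= N^(2 - \<delta>); enlarging the exponent to the maximum is harmless as N >= 1.\<close>
    have "N powr (2 + \<epsilon>) * real q \<le> N powr (2 + \<epsilon>) * N powr (2 - \<delta>)"
      using q by (intro mult_left_mono) auto
    also have "\<dots> = N powr (4 - \<delta> + \<epsilon>)"
      by (simp add: algebra_simps flip: powr_add)
    also have "\<dots> \<le> N powr (max (7 / 2) (4 - \<delta>) + \<epsilon>)"
      using N by (intro powr_mono) auto
    finally have "N powr (2 + \<epsilon>) \<le> N powr (max (7 / 2) (4 - \<delta>) + \<epsilon>) / real q"
      using q(1) by (simp add: field_simps)
    moreover have "K \<ge> 0" using C(1) assms by (auto simp: K_def)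
    ultimately have "K * N powr (2 + \<epsilon>) \<le> K * (N powr (max (7 / 2) (4 - \<delta>) + \<epsilon>) / real q)"
      by (rule mult_left_mono)
    with bound show "(\<Sum>r\<in>{r. 1 \<le> r \<and> r \<le> q \<and> gcd r q = k}.
              (divisor_progression_sum M N q r - divisor_progression_main M N q k)\<^sup>2)
             \<le> K * N powr (max (7 / 2) (4 - \<delta>) + \<epsilon>) / real q"
      by simp
  qed
qed

end
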